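(* Let $N=\{1,\dots,n\}$, let $(\bm{x}_i,y_i)\in\mathbb{R}^d\times\{-1,1\}$ for $i\in N$, let $C>0$, and let $0\le\lambda_1\le\lambda_2\le\cdots\le\lambda_n$. The (Lagrangian) dual form of the problem (C-OWA-SVM) is given by $$\max_{\bm{\alpha},\bm{\eta}}\ \sum_{i=1}^n\alpha_i-\frac12\sum_{i=1}^n\sum_{j=1}^n\alpha_i\alpha_jy_iy_j\,\bm{x}_i\cdot\bm{x}_j$$ subject to $$\sum_{i=1}^n\alpha_iy_i=0,$$ $$\alpha_i\le\sum_{j=1}^n\eta_{ij}C\lambda_j,\quad i\in N,$$ $$\sum_{i=1}^n\eta_{ij}=1,\quad j\in N,$$ $$\sum_{j=1}^n\eta_{ij}=1,\quad i\in N,$$ $$\alpha_i\ge0,\quad i\in N,\qquad \eta_{ij}\ge0,\quad i,j\in N.$$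
   Context: The problem (C-OWA-SVM) is the convex quadratic program $$\min_{\bm{w},b,\bm{\xi},\bm{u},\bm{v}}\ \frac12\|\bm{w}\|_2^2+\sum_{i=1}^nu_i+\sum_{j=1}^nv_j$$ subject to $$y_i(\bm{w}^T\bm{x}_i+b)\ge1-\xi_i,\quad i\in N,$$ $$u_i+v_j\ge C\lambda_j\xi_i,\quad i,j\in N,$$ $$\bm{w}\in\mathbb{R}^d,\quad b\in\mathbb{R},\quad \xi_i\ge0\ (i\in N),\quad u_i\in\mathbb{R}\ (i\in N),\quad v_j\in\mathbb{R}\ (j\in N).$$ The dual is the Lagrangian dual (after elimination of the multipliers $\mu_i$) associated with the Lagrangian function $$L=\frac12\|\bm{w}\|_2^2+\sum_{i=1}^nu_i+\sum_{j=1}^nv_j+\sum_{i=1}^n\alpha_i\bigl[1-\xi_i-y_i(\bm{w}^T\bm{x}_i+b)\bigr]-\sum_{i=1}^n\mu_i\xi_i+\sum_{i=1}^n\sum_{j=1}^n\eta_{ij}(C\lambda_j\xi_i-u_i-v_j),$$ with multipliers $\alpha_i,\mu_i,\eta_{ij}\ge0$; that is, the problem of maximizing over nonnegative multipliers the infimum of $L$ over the primal variables $(\bm{w},b,\bm{\xi},\bm{u},\bm{v})$. The symbol $\cdot$ denotes the scalar product in $\mathbb{R}^d$. *)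

theory Defs
  imports "HOL-Analysis.Analysis"
begin

text \<open>
  The index set \<open>N\<close> is \<open>{1..n}\<close>, and vectors indexed by \<open>N\<close> (matrices indexed by \<open>N \<times> N\<close>) are
  functions on \<^typ>\<open>nat\<close>, of which only the values on \<open>N\<close> matter.
\<close>

definition owa_svm_objective ::
  "nat \<Rightarrow> (real^'d) \<times> real \<times> (nat \<Rightarrow> real) \<times> (nat \<Rightarrow> real) \<times> (nat \<Rightarrow> real) \<Rightarrow> real"
  where "owa_svm_objective n = (\<lambda>(w, b, \<xi>, u, v).
    1/2 * (norm w)\<^sup>2 + (\<Sum>i=1..n. u i) + (\<Sum>j=1..n. v j))"

definition owa_svm_feasible ::
  "nat \<Rightarrow> (nat \<Rightarrow> real^'d) \<Rightarrow> (nat \<Rightarrow> real) \<Rightarrow> real \<Rightarrow> (nat \<Rightarrow> real) \<Rightarrow>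
   (real^'d) \<times> real \<times> (nat \<Rightarrow> real) \<times> (nat \<Rightarrow> real) \<times> (nat \<Rightarrow> real) \<Rightarrow> bool"
  where "owa_svm_feasible n x y C lam = (\<lambda>(w, b, \<xi>, u, v).
    (\<forall>i\<in>{1..n}. y i * (w \<bullet> x i + b) \<ge> 1 - \<xi> i) \<and>
    (\<forall>i\<in>{1..n}. \<forall>j\<in>{1..n}. u i + v j \<ge> C * lam j * \<xi> i) \<and>
    (\<forall>i\<in>{1..n}. \<xi> i \<ge> 0))"

definition owa_svm_multipliers ::
  "nat \<Rightarrow> (nat \<Rightarrow> real) \<times> (nat \<Rightarrow> real) \<times> (nat \<Rightarrow> nat \<Rightarrow> real) \<Rightarrow> bool"
  where "owa_svm_multipliers n = (\<lambda>(\<alpha>, \<mu>, \<eta>).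
    (\<forall>i\<in>{1..n}. \<alpha> i \<ge> 0) \<and> (\<forall>i\<in>{1..n}. \<mu> i \<ge> 0) \<and>
    (\<forall>i\<in>{1..n}. \<forall>j\<in>{1..n}. \<eta> i j \<ge> 0))"

definition owa_svm_lagrangian ::
  "nat \<Rightarrow> (nat \<Rightarrow> real^'d) \<Rightarrow> (nat \<Rightarrow> real) \<Rightarrow> real \<Rightarrow> (nat \<Rightarrow> real) \<Rightarrow>
   (real^'d) \<times> real \<times> (nat \<Rightarrow> real) \<times> (nat \<Rightarrow> real) \<times> (nat \<Rightarrow> real) \<Rightarrow>
   (nat \<Rightarrow> real) \<times> (nat \<Rightarrow> real) \<times> (nat \<Rightarrow> nat \<Rightarrow> real) \<Rightarrow> real"
  where "owa_svm_lagrangian n x y C lam = (\<lambda>(w, b, \<xi>, u, v) (\<alpha>, \<mu>, \<eta>).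
    1/2 * (norm w)\<^sup>2 + (\<Sum>i=1..n. u i) + (\<Sum>j=1..n. v j)
    + (\<Sum>i=1..n. \<alpha> i * (1 - \<xi> i - y i * (w \<bullet> x i + b)))
    - (\<Sum>i=1..n. \<mu> i * \<xi> i)
    + (\<Sum>i=1..n. \<Sum>j=1..n. \<eta> i j * (C * lam j * \<xi> i - u i - v j)))"

text \<open>
  All constraints are dualized, the sign constraints on \<open>\<xi>\<close> included, so the infimum ranges over
  unrestricted primal variables. It may be \<open>-\<infinity>\<close>.
\<close>

definition owa_svm_dual_function ::
  "nat \<Rightarrow> (nat \<Rightarrow> real^'d) \<Rightarrow> (nat \<Rightarrow> real) \<Rightarrow> real \<Rightarrow> (nat \<Rightarrow> real) \<Rightarrow>
   (nat \<Rightarrow> real) \<times> (nat \<Rightarrow> real) \<times> (nat \<Rightarrow> nat \<Rightarrow> real) \<Rightarrow> ereal"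
  where "owa_svm_dual_function n x y C lam m = (INF p. ereal (owa_svm_lagrangian n x y C lam p m))"

definition owa_svm_dual_qp_objective ::
  "nat \<Rightarrow> (nat \<Rightarrow> real^'d) \<Rightarrow> (nat \<Rightarrow> real) \<Rightarrow> (nat \<Rightarrow> real) \<times> (nat \<Rightarrow> nat \<Rightarrow> real) \<Rightarrow> real"
  where "owa_svm_dual_qp_objective n x y = (\<lambda>(\<alpha>, \<eta>).
    (\<Sum>i=1..n. \<alpha> i) - 1/2 * (\<Sum>i=1..n. \<Sum>j=1..n. \<alpha> i * \<alpha> j * y i * y j * (x i \<bullet> x j)))"

definition owa_svm_dual_qp_feasible ::
  "nat \<Rightarrow> (nat \<Rightarrow> real) \<Rightarrow> real \<Rightarrow> (nat \<Rightarrow> real) \<Rightarrow>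
   (nat \<Rightarrow> real) \<times> (nat \<Rightarrow> nat \<Rightarrow> real) \<Rightarrow> bool"
  where "owa_svm_dual_qp_feasible n y C lam = (\<lambda>(\<alpha>, \<eta>).
    (\<Sum>i=1..n. \<alpha> i * y i) = 0 \<and>
    (\<forall>i\<in>{1..n}. \<alpha> i \<le> (\<Sum>j=1..n. \<eta> i j * C * lam j)) \<and>
    (\<forall>j\<in>{1..n}. (\<Sum>i=1..n. \<eta> i j) = 1) \<and>
    (\<forall>i\<in>{1..n}. (\<Sum>j=1..n. \<eta> i j) = 1) \<and>
    (\<forall>i\<in>{1..n}. \<alpha> i \<ge> 0) \<and>
    (\<forall>i\<in>{1..n}. \<forall>j\<in>{1..n}. \<eta> i j \<ge> 0))"

text \<open>
  The Lagrangian belongs to the primal problem: its supremum over the multipliers is the primal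
  objective on the primal feasible set, and \<open>\<infinity>\<close> elsewhere.
\<close>

lemma SUP_owa_svm_lagrangian:
  fixes x :: "nat \<Rightarrow> real^'d"
  shows "(SUP m\<in>Collect (owa_svm_multipliers n). ereal (owa_svm_lagrangian n x y C lam p m)) =
    (if owa_svm_feasible n x y C lam p then ereal (owa_svm_objective n p) else \<infinity>)"
proof -
  obtain w b \<xi> u v where p: "p = (w, b, \<xi>, u, v)" by (metis prod.exhaust)
  let ?L = "owa_svm_lagrangian n x y C lam p" and ?f = "owa_svm_objective n p"
  let ?M = "Collect (owa_svm_multipliers n)"
  let ?z = "\<lambda>_::nat. 0::real" and ?Z = "\<lambda>(_::nat) (_::nat). 0::real"
  let ?S = "SUP m\<in>?M. ereal (?L m)"
  have unbounded: "?S = \<infinity>"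
    if c: "c > 0" and M: "\<And>t. t \<ge> 0 \<Longrightarrow> m t \<in> ?M" and L: "\<And>t. ?L (m t) = ?f + t * c"
    for c :: real and m
  proof (rule SUP_PInfty)
    fix k :: nat
    define t where "t = max 0 ((real k - ?f) / c)"
    have "(real k - ?f) / c \<le> t" by (simp add: t_def)
    then have "real k \<le> ?L (m t)" using c by (simp add: L field_simps)
    moreover have "m t \<in> ?M" by (rule M) (simp add: t_def)
    ultimately show "\<exists>m\<in>?M. ereal (real k) \<le> ereal (?L m)" by (intro bexI[of _ "m t"]) simp_all
  qed
  show ?thesis
  proof (cases "owa_svm_feasible n x y C lam p")
    case True
    have "?S = ereal ?f"
    proof (rule antisym)
      show "?S \<le> ereal ?f"
      proof (rule SUP_least)
        fix m assume "m \<in> ?M"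
        moreover obtain \<alpha> \<mu> \<eta> where m: "m = (\<alpha>, \<mu>, \<eta>)" by (metis prod.exhaust)
        ultimately have nn: "\<And>i. i \<in> {1..n} \<Longrightarrow> \<alpha> i \<ge> 0" "\<And>i. i \<in> {1..n} \<Longrightarrow> \<mu> i \<ge> 0"
          "\<And>i j. i \<in> {1..n} \<Longrightarrow> j \<in> {1..n} \<Longrightarrow> \<eta> i j \<ge> 0"
          by (auto simp: owa_svm_multipliers_def)
        have "(\<Sum>i=1..n. \<alpha> i * (1 - \<xi> i - y i * (w \<bullet> x i + b))) \<le> 0"
          using True nn(1) by (intro sum_nonpos mult_nonneg_nonpos) (auto simp: owa_svm_feasible_def p)
        moreover have "(\<Sum>i=1..n. \<mu> i * \<xi> i) \<ge> 0"
          using True nn(2) by (intro sum_nonneg mult_nonneg_nonneg) (auto simp: owa_svm_feasible_def p)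
        moreover have "(\<Sum>i=1..n. \<Sum>j=1..n. \<eta> i j * (C * lam j * \<xi> i - u i - v j)) \<le> 0"
          using True nn(3) by (intro sum_nonpos mult_nonneg_nonpos)
            (auto simp: owa_svm_feasible_def p algebra_simps)
        ultimately show "ereal (?L m) \<le> ereal ?f"
          by (simp add: m p owa_svm_lagrangian_def owa_svm_objective_def)
      qed
      have "ereal ?f = ereal (?L (?z, ?z, ?Z))"
        by (simp add: p owa_svm_lagrangian_def owa_svm_objective_def)
      also have "\<dots> \<le> ?S"
        by (rule SUP_upper) (simp add: owa_svm_multipliers_def)
      finally show "ereal ?f \<le> ?S" .
    qed
    with True show ?thesis by simp
  next
    case False
    then consider
      (margin) i where "i \<in> {1..n}" "1 - \<xi> i - y i * (w \<bullet> x i + b) > 0"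
      | (owa) i j where "i \<in> {1..n}" "j \<in> {1..n}" "C * lam j * \<xi> i - u i - v j > 0"
      | (sign) i where "i \<in> {1..n}" "- \<xi> i > 0"
      unfolding owa_svm_feasible_def p by (force simp: not_le)
    then have "?S = \<infinity>"
    proof cases
      case margin
      show ?thesis
        by (rule unbounded[OF margin(2), where m = "\<lambda>t. (\<lambda>k. if k = i then t else 0, ?z, ?Z)"])
          (use margin(1) in \<open>auto simp: p owa_svm_multipliers_def owa_svm_lagrangian_def
            owa_svm_objective_def if_distrib[of "\<lambda>a. a * _"] sum.delta cong: if_cong\<close>)
    next
      case owa
      have *: "(\<Sum>k=1..n. \<Sum>l=1..n. (if k = i \<and> l = j then t else 0) * (C * lam l * \<xi> k - u k - v l))
          = t * (C * lam j * \<xi> i - u i - v j)" for t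
      proof -
        have "(\<Sum>l=1..n. (if k = i \<and> l = j then t else 0) * (C * lam l * \<xi> k - u k - v l))
          = (if k = i then t * (C * lam j * \<xi> i - u i - v j) else 0)" for k
          using owa(2) by (auto simp: if_distrib[of "\<lambda>a. a * _"] sum.delta cong: if_cong)
        then show ?thesis using owa(1) by (simp add: sum.delta)
      qed
      show ?thesis
        by (rule unbounded[OF owa(3), where m = "\<lambda>t. (?z, ?z, \<lambda>k l. if k = i \<and> l = j then t else 0)"])
          (auto simp: p owa_svm_multipliers_def owa_svm_lagrangian_def owa_svm_objective_def *[unfolded One_nat_def])
    next
      case sign
      show ?thesis
        by (rule unbounded[OF sign(2), where m = "\<lambda>t. (?z, \<lambda>k. if k = i then t else 0, ?Z)"])
          (use sign(1) in \<open>auto simp: p owa_svm_multipliers_def owa_svm_lagrangian_def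
            owa_svm_objective_def if_distrib[of "\<lambda>a. a * _"] sum.delta cong: if_cong\<close>)
    qed
    with False show ?thesis by simp
  qed
qed

end

theory Submission
  imports Defs
begin

text \<open>
  For fixed multipliers the Lagrangian is affine in \<open>(b, \<xi>, u, v)\<close> and a convex quadratic in \<open>w\<close>, and
  these blocks of variables separate (\<open>owa_svm_lagrangian_decomposition\<close>). An affine function is
  bounded below only if its linear part vanishes. Hence the dual function is \<open>-\<infinity>\<close> unless the
  coefficients of \<open>b\<close>, of every \<open>\<xi> i\<close>, of every \<open>u i\<close> and of every \<open>v j\<close> are all zero; in that case
  only the quadratic in \<open>w\<close> remains, and completing the square at \<open>w = (\<Sum>i. \<alpha> i * y i * x i)\<close>
  gives exactly the objective of the quadratic program (\<open>owa_svm_dual_function_eq\<close>).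

  The vanishing coefficients are the equality constraints of the quadratic program, together with
  \<open>\<alpha> i + \<mu> i = (\<Sum>j. \<eta> i j * C * lam j)\<close>. The multiplier \<open>\<mu>\<close> does not enter the value, so it is
  nothing but the slack of the constraint \<open>\<alpha> i \<le> (\<Sum>j. \<eta> i j * C * lam j)\<close>: eliminating it turns the
  equation into this inequality, and conversely the slack restores \<open>\<mu>\<close>.

  Suprema and maximizers of the two problems thus correspond, with one catch. If no
  multipliers gave a finite dual value, all of them would be maximizers of the constant \<open>-\<infinity>\<close>,
  whereas the quadratic program would have no feasible point and no maximizer. This is excluded by
  \<open>\<alpha> = 0\<close> and \<open>\<eta>\<close> the identity matrix, which is feasible as the weights are nonnegative
  (\<open>owa_svm_dual_qp_feasible_identity\<close>).
\<close>

section \<open>The dual function\<close>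

lemma INF_eq_MInfty_if_affine_on_line:
  fixes f :: "'a \<Rightarrow> real" and p :: "real \<Rightarrow> 'a"
  assumes "\<And>t. f (p t) = a + t * c" and "c \<noteq> 0"
  shows "(INF q. ereal (f q)) = -\<infinity>"
proof (rule ereal_bot)
  fix B :: real
  have "(INF q. ereal (f q)) \<le> ereal (f (p ((B - a) / c)))"
    by (rule INF_lower) simp
  also have "f (p ((B - a) / c)) = B"
    using assms by simp
  finally show "(INF q. ereal (f q)) \<le> ereal B" .
qed

text \<open>The vanishing of the coefficients of \<open>b\<close>, \<open>\<xi>\<close>, \<open>u\<close> and \<open>v\<close> in the Lagrangian.\<close>

definition owa_svm_stationary ::
  "nat \<Rightarrow> (nat \<Rightarrow> real) \<Rightarrow> real \<Rightarrow> (nat \<Rightarrow> real) \<Rightarrow>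
   (nat \<Rightarrow> real) \<times> (nat \<Rightarrow> real) \<times> (nat \<Rightarrow> nat \<Rightarrow> real) \<Rightarrow> bool"
  where "owa_svm_stationary n y C lam = (\<lambda>(\<alpha>, \<mu>, \<eta>).
    (\<Sum>i=1..n. \<alpha> i * y i) = 0 \<and>
    (\<forall>i\<in>{1..n}. (\<Sum>j=1..n. \<eta> i j * C * lam j) - \<alpha> i - \<mu> i = 0) \<and>
    (\<forall>i\<in>{1..n}. 1 - (\<Sum>j=1..n. \<eta> i j) = 0) \<and>
    (\<forall>j\<in>{1..n}. 1 - (\<Sum>i=1..n. \<eta> i j) = 0))"

lemma norm_weighted_sum_sq:
  fixes x :: "nat \<Rightarrow> 'a::real_inner"
  shows "(norm (\<Sum>i=1..n. (\<alpha> i * y i) *\<^sub>R x i))\<^sup>2 =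
    (\<Sum>i=1..n. \<Sum>j=1..n. \<alpha> i * \<alpha> j * y i * y j * (x i \<bullet> x j))"
  unfolding power2_norm_eq_inner inner_sum_left inner_sum_right
  by (auto intro!: sum.cong simp: mult_ac inner_commute)

text \<open>
  The value of every infimum can be read off once the primal variables are separated: each of the
  last five terms involves only one of \<open>w\<close>, \<open>b\<close>, \<open>\<xi>\<close>, \<open>u\<close>, \<open>v\<close>. The subtracted half of the
  completed square in \<open>w\<close> is the quadratic part of the dual objective.
\<close>

lemma owa_svm_lagrangian_decomposition:
  fixes x :: "nat \<Rightarrow> real^'d"
  shows "owa_svm_lagrangian n x y C lam (w, b, \<xi>, u, v) (\<alpha>, \<mu>, \<eta>) =
    owa_svm_dual_qp_objective n x y (\<alpha>, \<eta>)
    + 1/2 * (norm (w - (\<Sum>i=1..n. (\<alpha> i * y i) *\<^sub>R x i)))\<^sup>2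
    - b * (\<Sum>i=1..n. \<alpha> i * y i)
    + (\<Sum>i=1..n. \<xi> i * ((\<Sum>j=1..n. \<eta> i j * C * lam j) - \<alpha> i - \<mu> i))
    + (\<Sum>i=1..n. u i * (1 - (\<Sum>j=1..n. \<eta> i j)))
    + (\<Sum>j=1..n. v j * (1 - (\<Sum>i=1..n. \<eta> i j)))"
proof -
  let ?s = "\<Sum>i=1..n. (\<alpha> i * y i) *\<^sub>R x i"
  have square: "1/2 * (norm (w - ?s))\<^sup>2 = 1/2 * (norm w)\<^sup>2 - w \<bullet> ?s + 1/2 * (norm ?s)\<^sup>2"
    by (simp add: power2_norm_eq_inner inner_diff_left inner_diff_right inner_commute)
  have objective: "owa_svm_dual_qp_objective n x y (\<alpha>, \<eta>) = (\<Sum>i=1..n. \<alpha> i) - 1/2 * (norm ?s)\<^sup>2"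
    unfolding owa_svm_dual_qp_objective_def prod.case norm_weighted_sum_sq ..
  have margin: "(\<Sum>i=1..n. \<alpha> i * (1 - \<xi> i - y i * (w \<bullet> x i + b))) =
      (\<Sum>i=1..n. \<alpha> i) - (\<Sum>i=1..n. \<xi> i * \<alpha> i) - w \<bullet> ?s - b * (\<Sum>i=1..n. \<alpha> i * y i)"
    by (simp add: inner_sum_right sum_distrib_left flip: sum_subtractf)
       (auto intro!: sum.cong simp: algebra_simps)
  have "(\<Sum>i=1..n. \<Sum>j=1..n. \<eta> i j * (C * lam j * \<xi> i - u i - v j)) =
      (\<Sum>i=1..n. \<Sum>j=1..n. \<xi> i * (\<eta> i j * C * lam j))
      - (\<Sum>i=1..n. \<Sum>j=1..n. u i * \<eta> i j) - (\<Sum>i=1..n. \<Sum>j=1..n. v j * \<eta> i j)"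
    by (simp add: algebra_simps sum_subtractf sum.distrib)
  also have "(\<Sum>i=1..n. \<Sum>j=1..n. v j * \<eta> i j) = (\<Sum>j=1..n. \<Sum>i=1..n. v j * \<eta> i j)"
    by (rule sum.swap)
  finally have owa: "(\<Sum>i=1..n. \<Sum>j=1..n. \<eta> i j * (C * lam j * \<xi> i - u i - v j)) =
      (\<Sum>i=1..n. \<xi> i * (\<Sum>j=1..n. \<eta> i j * C * lam j))
      - (\<Sum>i=1..n. u i * (\<Sum>j=1..n. \<eta> i j)) - (\<Sum>j=1..n. v j * (\<Sum>i=1..n. \<eta> i j))"
    by (simp add: sum_distrib_left)
  show ?thesis
    unfolding owa_svm_lagrangian_def prod.case square objective margin owa
    by (simp add: right_diff_distrib sum_subtractf mult.commute[of "\<mu> _"])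
qed

text \<open>
  A nonzero coefficient of \<open>b\<close>, \<open>\<xi> k\<close>, \<open>u k\<close> or \<open>v k\<close> makes the Lagrangian a nonconstant affine function
  along the corresponding coordinate axis, so that its infimum is \<open>-\<infinity>\<close>. Otherwise the square in the
  decomposition is the only term left that depends on the primal variables.
\<close>

lemma owa_svm_dual_function_eq:
  fixes x :: "nat \<Rightarrow> real^'d"
  shows "owa_svm_dual_function n x y C lam (\<alpha>, \<mu>, \<eta>) =
    (if owa_svm_stationary n y C lam (\<alpha>, \<mu>, \<eta>)
     then ereal (owa_svm_dual_qp_objective n x y (\<alpha>, \<eta>)) else -\<infinity>)"
proof (cases "owa_svm_stationary n y C lam (\<alpha>, \<mu>, \<eta>)")
  case True
  let ?L = "\<lambda>p. owa_svm_lagrangian n x y C lam p (\<alpha>, \<mu>, \<eta>)"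
  let ?f = "owa_svm_dual_qp_objective n x y (\<alpha>, \<eta>)"
  let ?s = "\<Sum>i=1..n. (\<alpha> i * y i) *\<^sub>R x i"
  have L: "?L (w, b, \<xi>, u, v) = ?f + 1/2 * (norm (w - ?s))\<^sup>2" for w b \<xi> u v
    unfolding owa_svm_lagrangian_decomposition using True by (simp add: owa_svm_stationary_def)
  have "(INF p. ereal (?L p)) = ereal ?f"
  proof (rule antisym)
    have "(INF p. ereal (?L p)) \<le> ereal (?L (?s, 0, \<lambda>_. 0, \<lambda>_. 0, \<lambda>_. 0))"
      by (rule INF_lower) simp
    also have "?L (?s, 0, \<lambda>_. 0, \<lambda>_. 0, \<lambda>_. 0) = ?f"
      by (simp add: L)
    finally show "(INF p. ereal (?L p)) \<le> ereal ?f" .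
    show "ereal ?f \<le> (INF p. ereal (?L p))"
    proof (rule INF_greatest)
      fix p :: "(real^'d) \<times> real \<times> (nat \<Rightarrow> real) \<times> (nat \<Rightarrow> real) \<times> (nat \<Rightarrow> real)"
      show "ereal ?f \<le> ereal (?L p)"
        by (cases p) (simp add: L)
    qed
  qed
  with True show ?thesis by (simp add: owa_svm_dual_function_def)
next
  case False
  let ?z = "\<lambda>_::nat. 0::real"
  let ?e = "\<lambda>(k::nat) (t::real) i. if i = k then t else 0"
  let ?a = "owa_svm_lagrangian n x y C lam (0, 0, ?z, ?z, ?z) (\<alpha>, \<mu>, \<eta>)"
  have pick: "(\<Sum>i=1..n. ?e k t i * g i) = t * g k" if "k \<in> {1..n}" for k t and g :: "nat \<Rightarrow> real"
    using that by (simp add: if_distrib[of "\<lambda>a. a * _"] sum.delta cong: if_cong)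
  consider
    (b) "(\<Sum>i=1..n. \<alpha> i * y i) \<noteq> 0"
    | (xi) k where "k \<in> {1..n}" "(\<Sum>j=1..n. \<eta> k j * C * lam j) - \<alpha> k - \<mu> k \<noteq> 0"
    | (u) k where "k \<in> {1..n}" "1 - (\<Sum>j=1..n. \<eta> k j) \<noteq> 0"
    | (v) k where "k \<in> {1..n}" "1 - (\<Sum>i=1..n. \<eta> i k) \<noteq> 0"
    using False unfolding owa_svm_stationary_def by auto
  then have "owa_svm_dual_function n x y C lam (\<alpha>, \<mu>, \<eta>) = -\<infinity>"
    unfolding owa_svm_dual_function_def
  proof cases
    case b
    show "(INF p. ereal (owa_svm_lagrangian n x y C lam p (\<alpha>, \<mu>, \<eta>))) = -\<infinity>"
      by (rule INF_eq_MInfty_if_affine_on_line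
          [where p = "\<lambda>t. (0, t, ?z, ?z, ?z)" and a = ?a and c = "- (\<Sum>i=1..n. \<alpha> i * y i)"])
        (use b in \<open>simp_all add: owa_svm_lagrangian_decomposition\<close>)
  next
    case xi
    show "(INF p. ereal (owa_svm_lagrangian n x y C lam p (\<alpha>, \<mu>, \<eta>))) = -\<infinity>"
      by (rule INF_eq_MInfty_if_affine_on_line
          [where p = "\<lambda>t. (0, 0, ?e k t, ?z, ?z)" and a = ?a, OF _ xi(2)])
        (simp only: owa_svm_lagrangian_decomposition pick[OF xi(1)], simp)
  next
    case u
    show "(INF p. ereal (owa_svm_lagrangian n x y C lam p (\<alpha>, \<mu>, \<eta>))) = -\<infinity>"
      by (rule INF_eq_MInfty_if_affine_on_line
          [where p = "\<lambda>t. (0, 0, ?z, ?e k t, ?z)" and a = ?a, OF _ u(2)])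
        (simp only: owa_svm_lagrangian_decomposition pick[OF u(1)], simp)
  next
    case v
    show "(INF p. ereal (owa_svm_lagrangian n x y C lam p (\<alpha>, \<mu>, \<eta>))) = -\<infinity>"
      by (rule INF_eq_MInfty_if_affine_on_line
          [where p = "\<lambda>t. (0, 0, ?z, ?z, ?e k t)" and a = ?a, OF _ v(2)])
        (simp only: owa_svm_lagrangian_decomposition pick[OF v(1)], simp)
  qed
  with False show ?thesis by simp
qed

section \<open>Eliminating the multipliers of the sign constraints\<close>

definition owa_svm_slack ::
  "nat \<Rightarrow> real \<Rightarrow> (nat \<Rightarrow> real) \<Rightarrow> (nat \<Rightarrow> real) \<Rightarrow> (nat \<Rightarrow> nat \<Rightarrow> real) \<Rightarrow> nat \<Rightarrow> real"
  where "owa_svm_slack n C lam \<alpha> \<eta> i = (\<Sum>j=1..n. \<eta> i j * C * lam j) - \<alpha> i"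

lemma owa_svm_dual_qp_feasible_if_stationary:
  assumes "owa_svm_multipliers n (\<alpha>, \<mu>, \<eta>)" and "owa_svm_stationary n y C lam (\<alpha>, \<mu>, \<eta>)"
  shows "owa_svm_dual_qp_feasible n y C lam (\<alpha>, \<eta>)"
  unfolding owa_svm_dual_qp_feasible_def prod.case
proof (intro conjI ballI)
  fix i assume "i \<in> {1..n}"
  with assms have "\<mu> i \<ge> 0" "(\<Sum>j=1..n. \<eta> i j * C * lam j) - \<alpha> i - \<mu> i = 0"
    by (auto simp: owa_svm_multipliers_def owa_svm_stationary_def)
  then show "\<alpha> i \<le> (\<Sum>j=1..n. \<eta> i j * C * lam j)" by linarith
qed (use assms in \<open>auto simp: owa_svm_multipliers_def owa_svm_stationary_def\<close>)

lemma owa_svm_slack_multipliers: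
  assumes "owa_svm_dual_qp_feasible n y C lam (\<alpha>, \<eta>)"
  shows "owa_svm_multipliers n (\<alpha>, owa_svm_slack n C lam \<alpha> \<eta>, \<eta>)"
  using assms by (auto simp: owa_svm_dual_qp_feasible_def owa_svm_multipliers_def owa_svm_slack_def)

lemma owa_svm_dual_function_slack:
  fixes x :: "nat \<Rightarrow> real^'d"
  assumes "owa_svm_dual_qp_feasible n y C lam (\<alpha>, \<eta>)"
  shows "owa_svm_dual_function n x y C lam (\<alpha>, owa_svm_slack n C lam \<alpha> \<eta>, \<eta>) =
    ereal (owa_svm_dual_qp_objective n x y (\<alpha>, \<eta>))"
  using assms
  by (simp add: owa_svm_dual_function_eq owa_svm_dual_qp_feasible_def owa_svm_stationary_def
      owa_svm_slack_def)

lemma owa_svm_dual_function_finiteD: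
  fixes x :: "nat \<Rightarrow> real^'d"
  assumes "owa_svm_multipliers n (\<alpha>, \<mu>, \<eta>)"
    and "owa_svm_dual_function n x y C lam (\<alpha>, \<mu>, \<eta>) \<noteq> -\<infinity>"
  shows "owa_svm_dual_qp_feasible n y C lam (\<alpha>, \<eta>)"
    and "owa_svm_dual_function n x y C lam (\<alpha>, \<mu>, \<eta>) =
      ereal (owa_svm_dual_qp_objective n x y (\<alpha>, \<eta>))"
  using assms owa_svm_dual_qp_feasible_if_stationary[OF assms(1)]
  by (auto simp: owa_svm_dual_function_eq split: if_splits)

lemma SUP_owa_svm_dual_function_sign_multipliers:
  fixes x :: "nat \<Rightarrow> real^'d"
  assumes "\<forall>i\<in>{1..n}. \<alpha> i \<ge> 0" and "\<forall>i\<in>{1..n}. \<forall>j\<in>{1..n}. \<eta> i j \<ge> 0"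
  shows "(SUP \<mu>\<in>{\<mu>. \<forall>i\<in>{1..n}. \<mu> i \<ge> 0}. owa_svm_dual_function n x y C lam (\<alpha>, \<mu>, \<eta>)) =
    (if owa_svm_dual_qp_feasible n y C lam (\<alpha>, \<eta>)
     then ereal (owa_svm_dual_qp_objective n x y (\<alpha>, \<eta>)) else -\<infinity>)" (is "?S = ?R")
proof (rule antisym)
  show "?S \<le> ?R"
  proof (rule SUP_least)
    fix \<mu> :: "nat \<Rightarrow> real" assume "\<mu> \<in> {\<mu>. \<forall>i\<in>{1..n}. \<mu> i \<ge> 0}"
    with assms have "owa_svm_multipliers n (\<alpha>, \<mu>, \<eta>)"
      by (simp add: owa_svm_multipliers_def)
    from owa_svm_dual_function_finiteD[OF this, of x y C lam]
    show "owa_svm_dual_function n x y C lam (\<alpha>, \<mu>, \<eta>) \<le> ?R"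
      by (cases "owa_svm_dual_function n x y C lam (\<alpha>, \<mu>, \<eta>) = -\<infinity>") auto
  qed
  show "?R \<le> ?S"
  proof (cases "owa_svm_dual_qp_feasible n y C lam (\<alpha>, \<eta>)")
    case True
    then have "owa_svm_slack n C lam \<alpha> \<eta> \<in> {\<mu>. \<forall>i\<in>{1..n}. \<mu> i \<ge> 0}"
      using owa_svm_slack_multipliers by (auto simp: owa_svm_multipliers_def)
    then have "owa_svm_dual_function n x y C lam (\<alpha>, owa_svm_slack n C lam \<alpha> \<eta>, \<eta>) \<le> ?S"
      by (rule SUP_upper)
    with True show ?thesis by (simp add: owa_svm_dual_function_slack)
  qed simp
qed

lemma SUP_owa_svm_dual_function_multipliers:
  fixes x :: "nat \<Rightarrow> real^'d"
  shows "(SUP m\<in>Collect (owa_svm_multipliers n). owa_svm_dual_function n x y C lam m) =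
    (SUP q\<in>Collect (owa_svm_dual_qp_feasible n y C lam). ereal (owa_svm_dual_qp_objective n x y q))"
    (is "?S = ?R")
proof (rule antisym)
  show "?S \<le> ?R"
  proof (rule SUP_least)
    fix m assume m: "m \<in> Collect (owa_svm_multipliers n)"
    obtain \<alpha> \<mu> \<eta> where [simp]: "m = (\<alpha>, \<mu>, \<eta>)" by (metis prod.exhaust)
    show "owa_svm_dual_function n x y C lam m \<le> ?R"
    proof (cases "owa_svm_dual_function n x y C lam m = -\<infinity>")
      case False
      with m show ?thesis
        using owa_svm_dual_function_finiteD[of n \<alpha> \<mu> \<eta> x y C lam]
        by (auto intro!: SUP_upper)
    qed simp
  qed
  show "?R \<le> ?S"
  proof (rule SUP_least)
    fix q assume q: "q \<in> Collect (owa_svm_dual_qp_feasible n y C lam)"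
    obtain \<alpha> \<eta> where [simp]: "q = (\<alpha>, \<eta>)" by (metis prod.exhaust)
    have "owa_svm_dual_function n x y C lam (\<alpha>, owa_svm_slack n C lam \<alpha> \<eta>, \<eta>) \<le> ?S"
      using q owa_svm_slack_multipliers by (auto intro!: SUP_upper)
    with q show "ereal (owa_svm_dual_qp_objective n x y q) \<le> ?S"
      by (simp add: owa_svm_dual_function_slack)
  qed
qed

section \<open>Maximizers\<close>

lemma owa_svm_dual_qp_feasible_identity:
  assumes "C \<ge> 0" and "\<And>i. i \<in> {1..n} \<Longrightarrow> 0 \<le> lam i"
  shows "owa_svm_dual_qp_feasible n y C lam (\<lambda>_. 0, \<lambda>i j. if i = j then 1 else 0)"
  using assms
  by (auto simp: owa_svm_dual_qp_feasible_def if_distrib[of "\<lambda>a. a * _"] sum.delta sum.delta'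
      cong: if_cong)

text \<open>
  A feasible point of the quadratic program makes the dual value of every maximizer finite; on
  multipliers of finite dual value the two problems have the same values.
\<close>

lemma is_arg_max_owa_svm_dual_function_iff:
  fixes x :: "nat \<Rightarrow> real^'d"
  assumes "owa_svm_dual_qp_feasible n y C lam q0"
  shows "(\<exists>\<mu>. is_arg_max (owa_svm_dual_function n x y C lam) (owa_svm_multipliers n) (\<alpha>, \<mu>, \<eta>)) \<longleftrightarrow>
    is_arg_max (owa_svm_dual_qp_objective n x y) (owa_svm_dual_qp_feasible n y C lam) (\<alpha>, \<eta>)"
    (is "(\<exists>\<mu>. is_arg_max ?g ?M (\<alpha>, \<mu>, \<eta>)) \<longleftrightarrow> is_arg_max ?f ?F (\<alpha>, \<eta>)")
proof
  assume "\<exists>\<mu>. is_arg_max ?g ?M (\<alpha>, \<mu>, \<eta>)"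
  then obtain \<mu> where M: "?M (\<alpha>, \<mu>, \<eta>)" and max: "\<And>m. ?M m \<Longrightarrow> ?g m \<le> ?g (\<alpha>, \<mu>, \<eta>)"
    by (auto simp: is_arg_max_def not_less)
  have le: "ereal (?f q) \<le> ?g (\<alpha>, \<mu>, \<eta>)" if "?F q" for q
  proof -
    obtain \<beta> \<theta> where [simp]: "q = (\<beta>, \<theta>)" by (metis prod.exhaust)
    show ?thesis
      using max[OF owa_svm_slack_multipliers[of n y C lam \<beta> \<theta>]] that
      by (simp add: owa_svm_dual_function_slack)
  qed
  from le[OF assms] have "?g (\<alpha>, \<mu>, \<eta>) \<noteq> -\<infinity>" by auto
  note fin = owa_svm_dual_function_finiteD[OF M this]
  have "?f q \<le> ?f (\<alpha>, \<eta>)" if "?F q" for q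
    using le[OF that] fin(2) by simp
  with fin(1) show "is_arg_max ?f ?F (\<alpha>, \<eta>)"
    by (auto simp: is_arg_max_def not_less)
next
  assume "is_arg_max ?f ?F (\<alpha>, \<eta>)"
  then have F: "?F (\<alpha>, \<eta>)" and max: "\<And>q. ?F q \<Longrightarrow> ?f q \<le> ?f (\<alpha>, \<eta>)"
    by (auto simp: is_arg_max_def not_less)
  have "?g m \<le> ?g (\<alpha>, owa_svm_slack n C lam \<alpha> \<eta>, \<eta>)" if "?M m" for m
  proof (cases "?g m = -\<infinity>")
    case False
    obtain \<beta> \<nu> \<theta> where [simp]: "m = (\<beta>, \<nu>, \<theta>)" by (metis prod.exhaust)
    show ?thesis
      using owa_svm_dual_function_finiteD[of n \<beta> \<nu> \<theta> x y C lam] that False max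
      by (simp add: owa_svm_dual_function_slack[OF F])
  qed simp
  with owa_svm_slack_multipliers[OF F] show "\<exists>\<mu>. is_arg_max ?g ?M (\<alpha>, \<mu>, \<eta>)"
    by (auto simp: is_arg_max_def not_less)
qed

theorem proposition3p1:
  fixes n :: nat and x :: "nat \<Rightarrow> real^'d" and y :: "nat \<Rightarrow> real"
    and C :: real and lam :: "nat \<Rightarrow> real"
  assumes "n \<ge> 1"
    and "\<forall>i\<in>{1..n}. y i \<in> {-1, 1}"
    and "C > 0"
    and "0 \<le> lam 1" and "mono_on {1..n} lam"
  shows
    "(\<forall>\<alpha> \<eta>. (\<forall>i\<in>{1..n}. \<alpha> i \<ge> 0) \<and> (\<forall>i\<in>{1..n}. \<forall>j\<in>{1..n}. \<eta> i j \<ge> 0) \<longrightarrow>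
        (SUP \<mu>\<in>{\<mu>. \<forall>i\<in>{1..n}. \<mu> i \<ge> 0}. owa_svm_dual_function n x y C lam (\<alpha>, \<mu>, \<eta>)) =
        (if owa_svm_dual_qp_feasible n y C lam (\<alpha>, \<eta>)
         then ereal (owa_svm_dual_qp_objective n x y (\<alpha>, \<eta>)) else -\<infinity>)) \<and>
     (SUP m\<in>Collect (owa_svm_multipliers n). owa_svm_dual_function n x y C lam m) =
     (SUP q\<in>Collect (owa_svm_dual_qp_feasible n y C lam).
        ereal (owa_svm_dual_qp_objective n x y q)) \<and>
     (\<forall>\<alpha> \<eta>.
        (\<exists>\<mu>. is_arg_max (owa_svm_dual_function n x y C lam) (owa_svm_multipliers n) (\<alpha>, \<mu>, \<eta>)) \<longleftrightarrow>
        is_arg_max (owa_svm_dual_qp_objective n x y) (owa_svm_dual_qp_feasible n y C lam) (\<alpha>, \<eta>))"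
proof -
  have "0 \<le> lam i" if "i \<in> {1..n}" for i
  proof -
    have "lam 1 \<le> lam i"
      using \<open>mono_on {1..n} lam\<close> by (rule mono_onD) (use that \<open>n \<ge> 1\<close> in auto)
    with \<open>0 \<le> lam 1\<close> show ?thesis by linarith
  qed
  then have "owa_svm_dual_qp_feasible n y C lam (\<lambda>_. 0, \<lambda>i j. if i = j then 1 else 0)"
    using \<open>C > 0\<close> by (intro owa_svm_dual_qp_feasible_identity) auto
  then show ?thesis
    by (intro conjI allI impI SUP_owa_svm_dual_function_sign_multipliers
        SUP_owa_svm_dual_function_multipliers is_arg_max_owa_svm_dual_function_iff) auto
qed

end
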